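(* There exist absolute constants $0<c_1\le c_2$ such that for every integer $N>1$ there is a permutation $\sigma\in\Sigma_N$ with $$c_1\log N\le \|T_{\sigma,N}\|_{L^2\to L^2}\le c_2\log N .$$
   Context: $\mathbb{T}=\mathbb{R}/\mathbb{Z}$ with Lebesgue measure. $\Sigma_N$ is the set of all permutations (one-to-one maps onto itself) of $\{1,2,\ldots,N\}$. For an integer $N\ge 1$ and $\sigma\in\Sigma_N$ the operator $T_{\sigma,N}$ on $L^2(\mathbb{T})$ is $$T_{\sigma,N}f(x)=\max_{1\le m\le N}\left|\sum_{k=1}^m c_{\sigma(k)}e^{2\pi i\sigma(k)x}\right|,\qquad c_k=\int_{\mathbb{T}}f(x)e^{-2\pi ikx}\,dx,$$ and $\|T\|_{L^2\to L^2}=\sup_{\|f\|_2\le 1}\|Tf\|_2$. *)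

theory Defs
  imports "HOL-Analysis.Analysis" "HOL-Combinatorics.Permutations"
begin

text \<open>
  The circle \<open>\<real>/\<int>\<close> with Lebesgue measure is represented by the fundamental domain \<open>[0,1)\<close>:
  a function on the circle is a function on \<open>real\<close> of which only the values on \<open>[0,1)\<close> matter.
  Elements of \<open>L\<^sup>2\<close> are represented by functions rather than by classes modulo null sets.
\<close>

definition circle :: "real measure" where
  "circle = lebesgue_on {0..<1}"

definition L2 :: "(real \<Rightarrow> 'a::real_normed_vector) set" where
  "L2 = {f \<in> borel_measurable circle. integrable circle (\<lambda>x. (norm (f x))\<^sup>2)}"

definition L2_norm :: "(real \<Rightarrow> 'a::real_normed_vector) \<Rightarrow> ereal" where
  "L2_norm f = (if f \<in> L2 then ereal (sqrt (LINT x|circle. (norm (f x))\<^sup>2)) else \<infinity>)"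

definition L2_opnorm ::
  "((real \<Rightarrow> 'a::real_normed_vector) \<Rightarrow> (real \<Rightarrow> 'b::real_normed_vector)) \<Rightarrow> ereal" where
  "L2_opnorm T = (SUP f \<in> {f \<in> L2. L2_norm f \<le> 1}. L2_norm (T f))"

definition fourier_coeff :: "(real \<Rightarrow> complex) \<Rightarrow> int \<Rightarrow> complex" where
  "fourier_coeff f k = (LINT x|circle. f x * exp (- 2 * pi * \<i> * of_int k * of_real x))"

definition max_partial_sum :: "(nat \<Rightarrow> nat) \<Rightarrow> nat \<Rightarrow> (real \<Rightarrow> complex) \<Rightarrow> real \<Rightarrow> real" where
  "max_partial_sum \<sigma> N f x =
     Max ((\<lambda>m. cmod (\<Sum>k = 1..m. fourier_coeff f (int (\<sigma> k)) *
                        exp (2 * pi * \<i> * of_nat (\<sigma> k) * of_real x))) ` {1..N})"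

end

theory Submission
  imports Defs
begin

text \<open>
  The upper bound is the Rademacher--Menshov inequality, which holds for every order.

  The lower bound comes from two-dimensional Fourier analysis, where the maximal Hilbert transform
  over \<open>n\<close> uniformly distributed directions has norm of order \<open>log n\<close> on \<open>L\<^sup>2\<close>, as the function
  \<open>1/|x|\<close> shows. With \<open>P = 2\<^bsup>4j\<^esup>\<close>, the lattice points \<open>(a, b)\<close>, \<open>0 \<le> b < a < P\<close>, are embedded as
  the frequencies \<open>aP + b\<close>, which are ordered by decreasing slope \<open>b/a\<close> and given coefficients
  comparable to \<open>1/a\<close>, the Fourier transform of \<open>1/|x|\<close>; the square of the norm of this function
  is of order \<open>j\<close>. Let \<open>x = (m - t)/P\<close> with a small \<open>t \<ge> 0\<close>. Stopping at the slope \<open>t/x\<close> makes one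
  end point of each geometric sum over \<open>b\<close> have phase near \<open>0\<close>, so that these contributions add up
  to order \<open>j/x\<close>, while those of the other end point oscillate. The square of \<open>j/x\<close> integrated over
  the set of these \<open>x\<close> is of order \<open>j\<^sup>3\<close>.
\<close>

section \<open>Trigonometric polynomials on the circle\<close>

definition wave :: "int \<Rightarrow> real \<Rightarrow> complex" where
  "wave k x = cis (2 * pi * of_int k * x)"

lemma exp_eq_wave:
  "exp (2 * pi * \<i> * of_nat k * of_real x) = wave (int k) x"
  "exp (- 2 * pi * \<i> * of_int j * of_real x) = wave (- j) x"
  by (simp_all add: wave_def cis_conv_exp mult_ac)

lemma norm_wave [simp]: "cmod (wave k x) = 1"
  by (simp add: wave_def)

lemma cnj_wave [simp]: "cnj (wave k x) = wave (- k) x"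
  by (simp add: wave_def cis_cnj)

lemma wave_mult: "wave j x * wave k x = wave (j + k) x"
  by (simp add: wave_def cis_mult algebra_simps)

lemma continuous_on_wave [continuous_intros]: "continuous_on S (wave k)"
  unfolding wave_def by (intro continuous_intros)

lemma finite_measure_circle: "finite_measure circle"
  unfolding circle_def by (intro finite_measure_lebesgue_on bounded_set_imp_lmeasurable) auto

interpretation circle: finite_measure circle
  by (rule finite_measure_circle)

lemma measure_circle_space [simp]: "measure circle (space circle) = 1"
  by (simp add: circle_def measure_restrict_space)

lemma measurable_circle_continuous:
  "continuous_on UNIV f \<Longrightarrow> f \<in> borel_measurable circle"
  unfolding circle_def
  by (rule continuous_imp_measurable_on_sets_lebesgue) (auto intro: continuous_on_subset)

lemma integrable_circle_continuous:
  fixes f :: "real \<Rightarrow> 'a :: {banach, second_countable_topology}"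
  assumes "continuous_on UNIV f"
  shows "integrable circle f"
proof -
  \<comment> \<open>The bound is taken on the closed interval because the fundamental domain is not
    compact.\<close>
  have "compact (f ` {0..1})"
    using assms by (intro compact_continuous_image) (auto intro: continuous_on_subset)
  then obtain B where B: "\<And>x. x \<in> {0..1} \<Longrightarrow> norm (f x) \<le> B"
    by (meson bounded_iff compact_imp_bounded imageI)
  have "AE x in circle. norm (f x) \<le> B"
    by (rule AE_I2) (auto simp: circle_def intro!: B)
  then show ?thesis
    using measurable_circle_continuous[OF assms] by (rule circle.integrable_const_bound)
qed

lemma integral_wave: "(LINT x|circle. wave k x) = (if k = 0 then 1 else 0)"
proof (cases "k = 0")
  case True
  then show ?thesis by (simp add: wave_def)
next
  case False
  define F where "F x = wave k x / (2 * pi * \<i> * of_int k)" for x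
  have "(F has_vector_derivative wave k x) (at x within {0..1})" for x
  proof -
    have "((\<lambda>z. exp (2 * pi * \<i> * of_int k * z) / (2 * pi * \<i> * of_int k)) has_field_derivative
        exp (2 * pi * \<i> * of_int k * of_real x)) (at (of_real x))"
      using False by (auto intro!: derivative_eq_intros)
    from has_vector_derivative_real_field[OF this] show ?thesis
      by (simp add: F_def[abs_def] wave_def cis_conv_exp mult_ac)
  qed
  then have "(wave k has_integral (F 1 - F 0)) {0..1}"
    by (intro fundamental_theorem_of_calculus) auto
  moreover have "F 1 = F 0"
    using cis_multiple_2pi[of "of_int k"] by (simp add: F_def wave_def mult_ac)
  ultimately have "(wave k has_integral 0) {0..1}" by simp
  moreover have "{0..1} - {0..<1} \<union> ({0..<1} - {0..1}) = {1::real}" by auto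
  ultimately have "(wave k has_integral 0) {0..<1}"
    by (subst (asm) has_integral_spike_set_eq[where T = "{0..<1}"])
       (auto intro: negligible_subset[of "{1}"])
  moreover have "integrable circle (wave k)"
    by (intro integrable_circle_continuous continuous_intros)
  ultimately show ?thesis
    using False lebesgue_integral_eq_integral[of "{0..<1}" "wave k"]
    by (simp add: circle_def integral_unique)
qed

lemma cmod_sum_square:
  "of_real ((cmod (\<Sum>k\<in>A. c k))\<^sup>2) = (\<Sum>j\<in>A. \<Sum>k\<in>A. c j * cnj (c k))"
  by (simp only: complex_norm_square) (simp add: sum_product)

text \<open>Orthonormality of the waves. The injection \<open>\<phi>\<close> lets the terms be
  listed in the order of a permutation, as needed for blocks of consecutive terms of the rearranged
  series.\<close>

lemma integral_trig_poly_square: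
  fixes c :: "nat \<Rightarrow> complex"
  assumes "finite A" "inj_on \<phi> A"
  shows "(LINT x|circle. (cmod (\<Sum>k\<in>A. c k * wave (int (\<phi> k)) x))\<^sup>2) = (\<Sum>k\<in>A. (cmod (c k))\<^sup>2)"
proof -
  have "complex_of_real (LINT x|circle. (cmod (\<Sum>k\<in>A. c k * wave (int (\<phi> k)) x))\<^sup>2)
      = (LINT x|circle. (\<Sum>j\<in>A. \<Sum>k\<in>A. (c j * cnj (c k)) * wave (int (\<phi> j) - int (\<phi> k)) x))"
    unfolding integral_complex_of_real[symmetric] cmod_sum_square
    by (simp add: wave_mult[symmetric] mult_ac diff_conv_add_uminus del: add_uminus_conv_diff)
  also have "\<dots> = (\<Sum>j\<in>A. \<Sum>k\<in>A. (c j * cnj (c k)) * (if \<phi> j = \<phi> k then 1 else 0))"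
    by (subst Bochner_Integration.integral_sum Bochner_Integration.integral_mult_right,
        (intro integrable_circle_continuous continuous_intros)?)+
       (simp add: integral_wave)
  also have "\<dots> = (\<Sum>j\<in>A. \<Sum>k\<in>A. if j = k then c j * cnj (c k) else 0)"
    using assms(2) by (intro sum.cong refl) (auto dest: inj_onD)
  also have "\<dots> = of_real (\<Sum>k\<in>A. (cmod (c k))\<^sup>2)"
    using assms(1) by (simp add: complex_norm_square del: of_real_power)
  finally show ?thesis
    by (simp only: of_real_eq_iff)
qed

section \<open>Fourier coefficients and Bessel's inequality\<close>

lemma L2_integrable:
  fixes f :: "real \<Rightarrow> complex"
  assumes "f \<in> L2"
  shows "integrable circle f"
proof (rule Bochner_Integration.integrable_bound)
  show "integrable circle (\<lambda>x. 1 + (cmod (f x))\<^sup>2)"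
    using assms by (auto simp: L2_def)
  show "f \<in> borel_measurable circle"
    using assms by (auto simp: L2_def)
  have "a \<le> 1 + a\<^sup>2" for a :: real
    using zero_le_square[of a] zero_le_square[of "a - 1"]
    unfolding power2_eq_square left_diff_distrib right_diff_distrib by linarith
  then show "AE x in circle. norm (f x) \<le> norm (1 + (cmod (f x))\<^sup>2)"
    by (intro AE_I2) (simp add: abs_of_nonneg add_nonneg_nonneg)
qed

lemma integrable_mult_wave:
  assumes "integrable circle f"
  shows "integrable circle (\<lambda>x. f x * wave k x)"
proof (rule Bochner_Integration.integrable_bound[OF assms])
  have [measurable]: "wave k \<in> borel_measurable circle"
    by (intro measurable_circle_continuous continuous_intros)
  show "(\<lambda>x. f x * wave k x) \<in> borel_measurable circle"
    using assms by measurable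
qed (simp add: norm_mult)

lemma fourier_coeff_eq: "fourier_coeff f k = (LINT x|circle. f x * wave (- k) x)"
  by (simp add: fourier_coeff_def exp_eq_wave(2)[symmetric])

lemma fourier_coeff_trig_poly:
  assumes "finite A"
  shows "fourier_coeff (\<lambda>x. \<Sum>k\<in>A. c k * wave (int k) x) (int j) = (if j \<in> A then c j else 0)"
proof -
  have "fourier_coeff (\<lambda>x. \<Sum>k\<in>A. c k * wave (int k) x) (int j)
      = (LINT x|circle. (\<Sum>k\<in>A. c k * wave (int k - int j) x))"
    unfolding fourier_coeff_eq
    by (simp add: sum_distrib_right mult.assoc wave_mult)
  also have "\<dots> = (\<Sum>k\<in>A. c k * (if k = j then 1 else 0))"
    by (subst Bochner_Integration.integral_sum Bochner_Integration.integral_mult_right,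
        (intro integrable_circle_continuous continuous_intros)?)+
       (simp add: integral_wave)
  also have "\<dots> = (\<Sum>k\<in>A. if k = j then c k else 0)"
    by (intro sum.cong) auto
  finally show ?thesis
    using assms by simp
qed

text \<open>Expand the squared distance of f from its projection \<open>S\<close> onto the waves in
  \<open>A\<close>, which is nonnegative. The inner product of f with \<open>S\<close> and the
  squared norm of \<open>S\<close> are both the left-hand sum.\<close>

lemma bessel_inequality:
  fixes f :: "real \<Rightarrow> complex"
  assumes f: "f \<in> L2" and A: "finite A"
  shows "(\<Sum>k\<in>A. (cmod (fourier_coeff f (int k)))\<^sup>2) \<le> (LINT x|circle. (cmod (f x))\<^sup>2)"
proof -
  define c where "c k = fourier_coeff f (int k)" for k :: nat
  define S where "S x = (\<Sum>k\<in>A. c k * wave (int k) x)" for x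
  have S: "continuous_on UNIV S"
    unfolding S_def by (intro continuous_intros)
  have fi: "integrable circle f" "integrable circle (\<lambda>x. (cmod (f x))\<^sup>2)"
    using L2_integrable[OF f] f by (auto simp: L2_def)
  have cross: "f x * cnj (S x) = (\<Sum>k\<in>A. cnj (c k) * (f x * wave (- int k) x))" for x
    by (simp add: S_def sum_distrib_left mult_ac)
  have ci: "integrable circle (\<lambda>x. f x * cnj (S x))"
    unfolding cross by (intro Bochner_Integration.integrable_sum integrable_mult_right
        integrable_mult_wave fi)
  have Si: "integrable circle (\<lambda>x. (cmod (S x))\<^sup>2)"
    by (intro integrable_circle_continuous continuous_intros S)
  have SS: "(LINT x|circle. (cmod (S x))\<^sup>2) = (\<Sum>k\<in>A. (cmod (c k))\<^sup>2)"
    unfolding S_def using integral_trig_poly_square[OF A, of "\<lambda>k. k" c] by simp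
  have "(LINT x|circle. f x * cnj (S x)) = (\<Sum>k\<in>A. cnj (c k) * c k)"
    unfolding cross
    by (subst Bochner_Integration.integral_sum)
       (auto simp: c_def fourier_coeff_eq intro!: integrable_mult_right integrable_mult_wave fi)
  also have "\<dots> = of_real (\<Sum>k\<in>A. (cmod (c k))\<^sup>2)"
    by (simp add: complex_norm_square mult.commute del: of_real_power)
  finally have fS: "(LINT x|circle. Re (f x * cnj (S x))) = (\<Sum>k\<in>A. (cmod (c k))\<^sup>2)"
    using integral_Re[OF ci] by simp
  have "0 \<le> (LINT x|circle. (cmod (f x - S x))\<^sup>2)"
    by (intro integral_nonneg_AE AE_I2) simp
  also have "(\<lambda>x. (cmod (f x - S x))\<^sup>2)
      = (\<lambda>x. (cmod (f x))\<^sup>2 - 2 * Re (f x * cnj (S x)) + (cmod (S x))\<^sup>2)"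
    by (rule ext) (simp only: cmod_power2, simp add: power2_eq_square algebra_simps)
  also have "(LINT x|circle. \<dots> x) = (LINT x|circle. (cmod (f x))\<^sup>2)
      - 2 * (LINT x|circle. Re (f x * cnj (S x))) + (LINT x|circle. (cmod (S x))\<^sup>2)"
    using fi(2) integrable_Re[OF ci] Si by (simp del: times_complex.sel)
  finally show ?thesis
    unfolding SS fS by (simp add: c_def)
qed

section \<open>The Rademacher--Menshov inequality\<close>

lemma add_square_le:
  fixes p q t :: real
  assumes "t > 0"
  shows "(p + q)\<^sup>2 \<le> (1 + t) * p\<^sup>2 + (1 + 1 / t) * q\<^sup>2"
proof -
  have "(1 + t) * p\<^sup>2 + (1 + 1 / t) * q\<^sup>2 - (p + q)\<^sup>2 = (t * p - q)\<^sup>2 / t"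
    using assms by (simp add: power2_eq_square field_simps)
  also have "\<dots> \<ge> 0" using assms by simp
  finally show ?thesis by simp
qed

text \<open>Bisection: a partial sum over 2^(r+1) terms either ends in the left half or is the whole
  left half plus a partial sum of the right half. The majorant \<open>B\<close> is chosen before x
  and m, so its single integral controls all partial sums at once. Orthogonality enters only through
  the additive bound \<open>le\<close> on blocks.\<close>

lemma rademacher_menshov:
  fixes \<psi> :: "nat \<Rightarrow> 'a \<Rightarrow> 'b :: real_normed_vector" and A :: "nat \<Rightarrow> real"
  assumes int: "\<And>a b. integrable M (\<lambda>x. (norm (\<Sum>k=a..<b. \<psi> k x))\<^sup>2)"
    and le: "\<And>a b. (LINT x|M. (norm (\<Sum>k=a..<b. \<psi> k x))\<^sup>2) \<le> (\<Sum>k=a..<b. A k)"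
  shows "\<exists>B. integrable M B \<and> (\<forall>x. \<forall>m\<le>2 ^ r. (norm (\<Sum>k=a..<a+m. \<psi> k x))\<^sup>2 \<le> B x)
    \<and> (LINT x|M. B x) \<le> (real r + 1)\<^sup>2 * (\<Sum>k=a..<a+2^r. A k)"
proof (induction r arbitrary: a)
  case 0
  have "(norm (\<Sum>k=a..<a+m. \<psi> k x))\<^sup>2 \<le> (norm (\<Sum>k=a..<a+1. \<psi> k x))\<^sup>2"
    if "m \<le> 2 ^ 0" for m x
    using that by (cases m) auto
  then show ?case
    using int[of a "a + 1"] le[of a "a + 1"]
    by (intro exI[of _ "\<lambda>x. (norm (\<Sum>k=a..<a+1. \<psi> k x))\<^sup>2"]) simp
next
  case (Suc r)
  let ?n = "2 ^ r :: nat"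
  let ?S = "\<lambda>a m x. \<Sum>k=a..<a+m. \<psi> k x"
  obtain B where B: "integrable M B" "\<And>x m. m \<le> ?n \<Longrightarrow> (norm (?S a m x))\<^sup>2 \<le> B x"
    "(LINT x|M. B x) \<le> (real r + 1)\<^sup>2 * (\<Sum>k=a..<a+?n. A k)"
    using Suc[of a] by blast
  obtain B' where B': "integrable M B'"
    "\<And>x m. m \<le> ?n \<Longrightarrow> (norm (?S (a + ?n) m x))\<^sup>2 \<le> B' x"
    "(LINT x|M. B' x) \<le> (real r + 1)\<^sup>2 * (\<Sum>k=a+?n..<a+?n+?n. A k)"
    using Suc[of "a + ?n"] by blast
  have nonneg: "B x \<ge> 0" "B' x \<ge> 0" for x
    using B(2)[of 0 x] B'(2)[of 0 x] by auto
  \<comment> \<open>This weight in \<open>(p + q)\<^sup>2 \<le> (1 + t) p\<^sup>2 + (1 + 1/t) q\<^sup>2\<close> turns \<open>(r + 1)\<^sup>2\<close> into exactly \<open>(r + 2)\<^sup>2\<close>.\<close>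
  define t where "t = real r + 1"
  have t: "t > 0" by (simp add: t_def)
  define C where "C x = (1 + t) * (norm (?S a ?n x))\<^sup>2 + (1 + 1 / t) * (B x + B' x)" for x
  have intC: "integrable M C"
    unfolding C_def using B(1) B'(1) int by auto
  have bound: "(norm (?S a m x))\<^sup>2 \<le> C x" if m: "m \<le> 2 ^ Suc r" for m x
  proof (cases "m \<le> ?n")
    case True
    have "(norm (?S a m x))\<^sup>2 \<le> B x" using B(2) True by blast
    also have "\<dots> \<le> 1 * (B x + B' x)" using nonneg by simp
    also have "\<dots> \<le> (1 + 1 / t) * (B x + B' x)"
      using nonneg[of x] t by (intro mult_right_mono) auto
    also have "\<dots> \<le> C x"
      using t by (simp add: C_def)
    finally show ?thesis .
  next
    case False
    define l where "l = m - ?n"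
    have l: "l \<le> ?n" "m = ?n + l" using m False by (auto simp: l_def)
    have "?S a m x = ?S a ?n x + ?S (a + ?n) l x"
      unfolding l(2) by (simp add: sum.atLeastLessThan_concat add.assoc)
    then have "(norm (?S a m x))\<^sup>2 \<le> (norm (?S a ?n x) + norm (?S (a + ?n) l x))\<^sup>2"
      by (simp add: power_mono norm_triangle_ineq)
    also have "\<dots> \<le> (1 + t) * (norm (?S a ?n x))\<^sup>2 + (1 + 1 / t) * (norm (?S (a + ?n) l x))\<^sup>2"
      using t by (rule add_square_le)
    also have "\<dots> \<le> C x"
      unfolding C_def using B'(2)[OF l(1), of x] nonneg(1)[of x] t
      by (intro add_left_mono mult_left_mono) auto
    finally show ?thesis .
  qed
  let ?AL = "\<Sum>k=a..<a+?n. A k" and ?AR = "\<Sum>k=a+?n..<a+?n+?n. A k"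
  \<comment> \<open>Individual values of \<open>A\<close> may be negative, but a block sum of
    \<open>A\<close> dominates the integral of a square. This permits enlarging \<open>?AL\<close>
    to \<open>?AL + ?AR\<close> in the bound for the full left block.\<close>
  have "0 \<le> (LINT x|M. (norm (?S (a + ?n) ?n x))\<^sup>2)" by simp
  then have AR: "0 \<le> ?AR" using le[of "a + ?n" "a + ?n + ?n"] by linarith
  have "(LINT x|M. C x) = (1 + t) * (LINT x|M. (norm (?S a ?n x))\<^sup>2)
      + (1 + 1 / t) * ((LINT x|M. B x) + (LINT x|M. B' x))"
    unfolding C_def using B(1) B'(1) int by simp
  also have "\<dots> \<le> (1 + t) * (?AL + ?AR) + (1 + 1 / t) * (t\<^sup>2 * ?AL + t\<^sup>2 * ?AR)"
    using B(3) B'(3) le[of a "a + ?n"] AR t unfolding t_def[symmetric]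
    by (intro add_mono mult_left_mono) auto
  also have "\<dots> = (t + 1)\<^sup>2 * (?AL + ?AR)"
    using t by (simp add: field_simps power2_eq_square)
  also have "?AL + ?AR = (\<Sum>k=a..<a+2^Suc r. A k)"
    by (simp add: sum.atLeastLessThan_concat mult_2 add.assoc)
  finally have "(LINT x|M. C x) \<le> (real (Suc r) + 1)\<^sup>2 * (\<Sum>k=a..<a+2^Suc r. A k)"
    by (simp add: t_def add_ac)
  with intC bound show ?case by blast
qed

section \<open>The maximal partial sum and its upper bound\<close>

lemma max_partial_sum_eq:
  "max_partial_sum \<sigma> N f x =
    Max ((\<lambda>m. cmod (\<Sum>k=1..m. fourier_coeff f (int (\<sigma> k)) * wave (int (\<sigma> k)) x)) ` {1..N})"
  by (simp only: max_partial_sum_def exp_eq_wave)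

lemma max_partial_sum_ge:
  assumes "m \<le> N" "N \<ge> 1"
  shows "cmod (\<Sum>k=1..m. fourier_coeff f (int (\<sigma> k)) * wave (int (\<sigma> k)) x)
    \<le> max_partial_sum \<sigma> N f x"
proof (cases "m = 0")
  case True
  have "0 \<le> cmod (\<Sum>k=1..1. fourier_coeff f (int (\<sigma> k)) * wave (int (\<sigma> k)) x)"
    by simp
  also have "\<dots> \<le> max_partial_sum \<sigma> N f x"
    unfolding max_partial_sum_eq using assms by (intro Max_ge finite_imageI imageI) auto
  finally show ?thesis using True by simp
next
  case False
  then show ?thesis
    unfolding max_partial_sum_eq using assms by (intro Max_ge) auto
qed

lemma max_partial_sum_nonneg: "N \<ge> 1 \<Longrightarrow> 0 \<le> max_partial_sum \<sigma> N f x"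
  using max_partial_sum_ge[of 0 N f \<sigma> x] by simp

lemma measurable_max_partial_sum [measurable]:
  "max_partial_sum \<sigma> N f \<in> borel_measurable circle"
  unfolding max_partial_sum_eq[abs_def]
  by (intro borel_measurable_Max measurable_circle_continuous continuous_intros) auto

text \<open>The Rademacher-Menshov majorant is applied to the terms in the order
  \<open>\<sigma>\<close>. The sum of the squared coefficients does not depend on the order, so
  Bessel's inequality gives a bound that is uniform in \<open>\<sigma>\<close>.\<close>

lemma max_partial_sum_L2:
  fixes f :: "real \<Rightarrow> complex"
  assumes \<sigma>: "\<sigma> permutes {1..N}" and N: "1 \<le> N" "N \<le> 2 ^ r" and f: "f \<in> L2"
  shows "max_partial_sum \<sigma> N f \<in> L2"
    and "(LINT x|circle. (max_partial_sum \<sigma> N f x)\<^sup>2) \<le> (real r + 1)\<^sup>2 * (LINT x|circle. (cmod (f x))\<^sup>2)"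
proof -
  define c where "c k = fourier_coeff f (int (\<sigma> k))" for k
  \<comment> \<open>Extension by zero outside 1, ..., N makes the number of terms a power of
    two.\<close>
  define \<psi> where "\<psi> k x = (if k \<in> {1..N} then c k * wave (int (\<sigma> k)) x else 0)" for k x
  define A where "A k = (if k \<in> {1..N} then (cmod (c k))\<^sup>2 else 0)" for k
  have sum_\<psi>: "(\<Sum>k=a..<b. \<psi> k x) = (\<Sum>k\<in>{a..<b}\<inter>{1..N}. c k * wave (int (\<sigma> k)) x)" for a b x
    unfolding \<psi>_def by (rule sum.inter_restrict[symmetric]) simp
  have int: "integrable circle (\<lambda>x. (norm (\<Sum>k=a..<b. \<psi> k x))\<^sup>2)" for a b
    unfolding sum_\<psi> by (intro integrable_circle_continuous continuous_intros)
  have le: "(LINT x|circle. (norm (\<Sum>k=a..<b. \<psi> k x))\<^sup>2) \<le> (\<Sum>k=a..<b. A k)" for a b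
  proof -
    have "(LINT x|circle. (norm (\<Sum>k=a..<b. \<psi> k x))\<^sup>2) = (\<Sum>k\<in>{a..<b}\<inter>{1..N}. (cmod (c k))\<^sup>2)"
      unfolding sum_\<psi> using permutes_inj[OF \<sigma>]
      by (intro integral_trig_poly_square) (auto intro: inj_on_subset)
    also have "\<dots> = (\<Sum>k=a..<b. A k)"
      unfolding A_def by (rule sum.inter_restrict) simp
    finally show ?thesis by simp
  qed
  obtain B where B: "integrable circle B"
    "\<And>x m. m \<le> 2 ^ r \<Longrightarrow> (norm (\<Sum>k=1..<1+m. \<psi> k x))\<^sup>2 \<le> B x"
    "(LINT x|circle. B x) \<le> (real r + 1)\<^sup>2 * (\<Sum>k=1..<1+2^r. A k)"
    using rademacher_menshov[of circle \<psi> A r 1, OF int le] by blast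
  have bound: "(max_partial_sum \<sigma> N f x)\<^sup>2 \<le> B x" for x
  proof -
    have "max_partial_sum \<sigma> N f x \<in>
        (\<lambda>m. cmod (\<Sum>k=1..m. c k * wave (int (\<sigma> k)) x)) ` {1..N}"
      unfolding max_partial_sum_eq c_def using N by (intro Max_in) auto
    then obtain m where m: "m \<in> {1..N}"
      "max_partial_sum \<sigma> N f x = cmod (\<Sum>k=1..m. c k * wave (int (\<sigma> k)) x)"
      by blast
    have "(\<Sum>k=1..m. c k * wave (int (\<sigma> k)) x) = (\<Sum>k=1..<1+m. \<psi> k x)"
      using m(1) by (intro sum.cong) (auto simp: \<psi>_def)
    then show ?thesis
      using B(2)[of m x] m N by simp
  qed
  have int': "integrable circle (\<lambda>x. (max_partial_sum \<sigma> N f x)\<^sup>2)"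
    by (rule Bochner_Integration.integrable_bound[OF B(1)])
       (auto intro!: AE_I2 order.trans[OF bound])
  then show "max_partial_sum \<sigma> N f \<in> L2"
    by (simp add: L2_def)
  have "(\<Sum>k=1..<1+2^r. A k) = (\<Sum>k\<in>{1..<1+2^r}\<inter>{1..N}. (cmod (c k))\<^sup>2)"
    unfolding A_def by (rule sum.inter_restrict[symmetric]) simp
  also have "{1..<1+2^r}\<inter>{1..N} = {1..N}"
    using N by auto
  also have "(\<Sum>k\<in>{1..N}. (cmod (c k))\<^sup>2) = (\<Sum>k\<in>{1..N}. (cmod (fourier_coeff f (int k)))\<^sup>2)"
    unfolding c_def by (rule sum.reindex_bij_betw[OF permutes_imp_bij[OF \<sigma>]])
  also have "\<dots> \<le> (LINT x|circle. (cmod (f x))\<^sup>2)"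
    by (rule bessel_inequality[OF f]) simp
  finally have A: "(\<Sum>k=1..<1+2^r. A k) \<le> (LINT x|circle. (cmod (f x))\<^sup>2)" .
  have "(LINT x|circle. (max_partial_sum \<sigma> N f x)\<^sup>2) \<le> (LINT x|circle. B x)"
    using int' B(1) bound by (intro integral_mono) auto
  also note B(3)
  also have "(real r + 1)\<^sup>2 * (\<Sum>k=1..<1+2^r. A k) \<le> (real r + 1)\<^sup>2 * (LINT x|circle. (cmod (f x))\<^sup>2)"
    using A by (intro mult_left_mono) auto
  finally show "(LINT x|circle. (max_partial_sum \<sigma> N f x)\<^sup>2)
      \<le> (real r + 1)\<^sup>2 * (LINT x|circle. (cmod (f x))\<^sup>2)" .
qed

lemma L2_norm_le_iff:
  "c \<ge> 0 \<Longrightarrow> L2_norm f \<le> ereal c \<longleftrightarrow> f \<in> L2 \<and> (LINT x|circle. (norm (f x))\<^sup>2) \<le> c\<^sup>2"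
  by (auto simp: L2_norm_def real_le_lsqrt sqrt_le_D)

lemma opnorm_max_partial_sum_le:
  assumes "\<sigma> permutes {1..N}" "1 \<le> N" "N \<le> 2 ^ r"
  shows "L2_opnorm (max_partial_sum \<sigma> N) \<le> ereal (real r + 1)"
  unfolding L2_opnorm_def
proof (rule SUP_least)
  fix f :: "real \<Rightarrow> complex"
  assume "f \<in> {f \<in> L2. L2_norm f \<le> 1}"
  then have f: "f \<in> L2" "(LINT x|circle. (cmod (f x))\<^sup>2) \<le> 1"
    using L2_norm_le_iff[of 1 f] by (auto simp: one_ereal_def)
  have "(LINT x|circle. (max_partial_sum \<sigma> N f x)\<^sup>2) \<le> (real r + 1)\<^sup>2 * 1"
    by (rule order.trans[OF max_partial_sum_L2(2)[OF assms f(1)]])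
       (intro mult_left_mono f, simp)
  then show "L2_norm (max_partial_sum \<sigma> N f) \<le> ereal (real r + 1)"
    using max_partial_sum_L2(1)[OF assms f(1)] by (subst L2_norm_le_iff) auto
qed

section \<open>Lower bounds for the norm\<close>

text \<open>By homogeneity f may be divided by the square root of \<open>D\<close>; an upper bound
  \<open>D\<close> for the squared norm suffices in place of its exact value.\<close>

lemma opnorm_max_partial_sum_ge:
  assumes \<sigma>: "\<sigma> permutes {1..N}" and N: "1 \<le> N" and f: "f \<in> L2"
    and D: "(LINT x|circle. (cmod (f x))\<^sup>2) \<le> D" "D > 0"
    and c: "0 \<le> c" "c\<^sup>2 * D \<le> (LINT x|circle. (max_partial_sum \<sigma> N f x)\<^sup>2)"
  shows "ereal c \<le> L2_opnorm (max_partial_sum \<sigma> N)"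
proof -
  define \<alpha> where "\<alpha> = 1 / sqrt D"
  have \<alpha>: "\<alpha> > 0" "\<alpha>\<^sup>2 = 1 / D"
    using D(2) by (auto simp: \<alpha>_def power_divide)
  define g where "g x = of_real \<alpha> * f x" for x
  have sq: "(\<lambda>x. (cmod (g x))\<^sup>2) = (\<lambda>x. \<alpha>\<^sup>2 * (cmod (f x))\<^sup>2)"
    by (simp add: g_def norm_mult power_mult_distrib)
  have g: "g \<in> L2"
    using f unfolding L2_def sq mem_Collect_eq by (auto simp: g_def[abs_def])
  have "(LINT x|circle. (cmod (g x))\<^sup>2) \<le> 1\<^sup>2"
    unfolding sq using D by (simp add: \<alpha> field_simps)
  with g have g1: "L2_norm g \<le> 1"
    using L2_norm_le_iff[of 1 g] by (simp add: one_ereal_def)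
  have coeff: "fourier_coeff g k = of_real \<alpha> * fourier_coeff f k" for k
    by (simp add: fourier_coeff_def g_def mult.assoc)
  have "max_partial_sum \<sigma> N g x = \<alpha> * max_partial_sum \<sigma> N f x" for x
  proof -
    have "max_partial_sum \<sigma> N g x = Max ((\<lambda>y. \<alpha> * y) ` (\<lambda>m. cmod
        (\<Sum>k=1..m. fourier_coeff f (int (\<sigma> k)) * wave (int (\<sigma> k)) x)) ` {1..N})"
      unfolding max_partial_sum_eq coeff image_image using \<alpha>
      by (simp add: mult.assoc norm_mult flip: sum_distrib_left)
    also have "\<dots> = \<alpha> * max_partial_sum \<sigma> N f x"
      unfolding max_partial_sum_eq using \<alpha> N
      by (intro mono_Max_commute[symmetric]) (auto intro!: monoI)
    finally show ?thesis .
  qed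
  then have "(LINT x|circle. (max_partial_sum \<sigma> N g x)\<^sup>2)
      = \<alpha>\<^sup>2 * (LINT x|circle. (max_partial_sum \<sigma> N f x)\<^sup>2)"
    by (simp add: power_mult_distrib)
  also have "\<dots> \<ge> \<alpha>\<^sup>2 * (c\<^sup>2 * D)"
    using c by (intro mult_left_mono) auto
  finally have "c\<^sup>2 \<le> (LINT x|circle. (max_partial_sum \<sigma> N g x)\<^sup>2)"
    using \<alpha> D by simp
  \<comment> \<open>Both branches of \<open>L2_norm\<close> give this, since its value outside
    \<open>L2\<close> is infinity.\<close>
  then have "ereal c \<le> L2_norm (max_partial_sum \<sigma> N g)"
    by (simp add: L2_norm_def real_le_rsqrt)
  also have "\<dots> \<le> L2_opnorm (max_partial_sum \<sigma> N)"
    unfolding L2_opnorm_def using g g1 by (intro SUP_upper) auto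
  finally show ?thesis .
qed

lemma trig_poly_L2:
  fixes c :: "nat \<Rightarrow> complex"
  assumes "finite A"
  defines "f \<equiv> \<lambda>x. \<Sum>k\<in>A. c k * wave (int k) x"
  shows "f \<in> L2" "(LINT x|circle. (cmod (f x))\<^sup>2) = (\<Sum>k\<in>A. (cmod (c k))\<^sup>2)"
proof -
  have "continuous_on UNIV f"
    unfolding f_def by (intro continuous_intros)
  then show "f \<in> L2"
    unfolding L2_def
    by (auto intro!: measurable_circle_continuous integrable_circle_continuous continuous_intros)
  show "(LINT x|circle. (cmod (f x))\<^sup>2) = (\<Sum>k\<in>A. (cmod (c k))\<^sup>2)"
    unfolding f_def using integral_trig_poly_square[OF assms(1), of "\<lambda>k. k" c] by simp
qed

text \<open>This serves the small N. The test function is the single wave of frequency 1, which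
  every permutation of 1, ..., N contains, so that the sum with m = N has modulus 1.\<close>

lemma opnorm_max_partial_sum_ge_1:
  assumes \<sigma>: "\<sigma> permutes {1..N}" and N: "1 \<le> N"
  shows "ereal 1 \<le> L2_opnorm (max_partial_sum \<sigma> N)"
proof -
  define f where "f x = (\<Sum>k\<in>{1::nat}. 1 * wave (int k) x)" for x
  note f = trig_poly_L2[of "{1}" "\<lambda>_. 1", folded f_def]
  have coeff: "fourier_coeff f (int k) = (if k = 1 then 1 else 0)" for k
    unfolding f_def by (subst fourier_coeff_trig_poly) auto
  have "1 \<le> max_partial_sum \<sigma> N f x" for x
  proof -
    have "(\<Sum>k=1..N. fourier_coeff f (int (\<sigma> k)) * wave (int (\<sigma> k)) x)
        = (\<Sum>k=1..N. fourier_coeff f (int k) * wave (int k) x)"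
      by (rule sum.reindex_bij_betw[OF permutes_imp_bij[OF \<sigma>]])
    also have "\<dots> = (\<Sum>k=1..N. if k = 1 then wave 1 x else 0)"
      unfolding coeff by (intro sum.cong) auto
    also have "\<dots> = wave 1 x"
      using N by simp
    finally show ?thesis
      using max_partial_sum_ge[of N N f \<sigma> x] N by simp
  qed
  then have ge: "1 \<le> (max_partial_sum \<sigma> N f x)\<^sup>2" for x
    by (simp add: one_le_power)
  \<comment> \<open>Only membership in \<open>L2\<close> is wanted here, so the crude exponent r = N
    is good enough.\<close>
  have "N \<le> 2 ^ N" by (simp add: less_imp_le)
  then have "integrable circle (\<lambda>x. (max_partial_sum \<sigma> N f x)\<^sup>2)"
    using max_partial_sum_L2(1)[OF \<sigma> N _ f(1), of N] by (simp add: L2_def)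
  then have "(LINT x|circle. 1) \<le> (LINT x|circle. (max_partial_sum \<sigma> N f x)\<^sup>2)"
    using ge by (intro integral_mono) auto
  then show ?thesis
    using f by (intro opnorm_max_partial_sum_ge[OF \<sigma> N, of f 1]) auto
qed

text \<open>Sorting by decreasing key. One permutation serves all thresholds, so the threshold may
  later depend on x; elements with equal keys enter a superlevel set together, so their mutual order
  is free.\<close>

lemma ex_sorting_permutation:
  fixes key :: "nat \<Rightarrow> real"
  shows "\<exists>\<sigma>. \<sigma> permutes {1..N} \<and> (\<forall>\<theta>. \<exists>m\<le>N. \<sigma> ` {1..m} = {k \<in> {1..N}. \<theta> \<le> key k})"
proof -
  have "\<exists>f. bij_betw f {1..card S} S \<and> (\<forall>\<theta>. \<exists>m\<le>card S. f ` {1..m} = {k \<in> S. \<theta> \<le> key k})"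
    if "finite S" for S
    using that
  \<comment> \<open>With the sign reversed, the inserted element has the smallest key so far and
    takes the last position.\<close>
  proof (induction S rule: finite_ranking_induct[where f = "\<lambda>k. - key k"])
    case empty
    show ?case by (intro exI[of _ id]) (auto simp: bij_betw_def)
  next
    case (insert x S)
    show ?case
    proof (cases "x \<in> S")
      case True
      then show ?thesis using insert by (simp add: insert_absorb)
    next
      case False
      let ?n = "card S"
      have card: "card (insert x S) = Suc ?n"
        using insert False by simp
      obtain f where f: "bij_betw f {1..?n} S"
        "\<And>\<theta>. \<exists>m\<le>?n. f ` {1..m} = {k \<in> S. \<theta> \<le> key k}"
        using insert by blast
      let ?g = "f(Suc ?n := x)"
      have eq: "?g ` {1..m} = f ` {1..m}" if "m \<le> ?n" for m
        using that by (intro image_cong) auto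
      have "{1..Suc ?n} = insert (Suc ?n) {1..?n}" by auto
      then have gS: "?g ` {1..Suc ?n} = insert x S"
        unfolding \<open>{1..Suc ?n} = _\<close> image_insert eq[OF order.refl]
        using f(1) by (simp add: bij_betw_def)
      have "bij_betw ?g {1..Suc ?n} (insert x S)"
        using gS card by (intro bij_betw_imageI eq_card_imp_inj_on) auto
      moreover have "\<exists>m\<le>Suc ?n. ?g ` {1..m} = {k \<in> insert x S. \<theta> \<le> key k}" for \<theta>
      proof (cases "\<theta> \<le> key x")
        case True
        have "{k \<in> insert x S. \<theta> \<le> key k} = insert x S"
          using True insert(2) by force
        then show ?thesis using gS by (metis order.refl)
      next
        case False
        then have "{k \<in> insert x S. \<theta> \<le> key k} = {k \<in> S. \<theta> \<le> key k}" by auto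
        then show ?thesis using f(2)[of \<theta>] eq by (metis le_SucI)
      qed
      ultimately show ?thesis unfolding card by blast
    qed
  qed
  from this[of "{1..N}"] obtain f where f: "bij_betw f {1..N} {1..N}"
    "\<And>\<theta>. \<exists>m\<le>N. f ` {1..m} = {k \<in> {1..N}. \<theta> \<le> key k}"
    by auto
  define \<sigma> where "\<sigma> i = (if i \<in> {1..N} then f i else i)" for i
  have "bij_betw \<sigma> {1..N} {1..N}"
    using f(1) by (rule bij_betw_cong[THEN iffD1, rotated]) (simp add: \<sigma>_def)
  then have "\<sigma> permutes {1..N}"
    by (rule bij_imp_permutes) (auto simp: \<sigma>_def)
  moreover have "\<sigma> ` {1..m} = f ` {1..m}" if "m \<le> N" for m
    using that by (intro image_cong) (auto simp: \<sigma>_def)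
  ultimately show ?thesis using f(2) by metis
qed

text \<open>Turns pointwise lower bounds into a bound for the norm, by comparing the square of g
  with a step function.\<close>

lemma integral_square_ge_disjoint:
  fixes g :: "real \<Rightarrow> real"
  assumes M: "finite M" "disjoint_family_on (\<lambda>m. {l m<..<u m}) M"
    and sub: "\<And>m. m \<in> M \<Longrightarrow> 0 \<le> l m \<and> l m \<le> u m \<and> u m \<le> 1"
    and g: "g \<in> L2"
    and C: "\<And>m x. m \<in> M \<Longrightarrow> x \<in> {l m<..<u m} \<Longrightarrow> 0 \<le> C m \<and> C m \<le> g x"
  shows "(\<Sum>m\<in>M. (C m)\<^sup>2 * (u m - l m)) \<le> (LINT x|circle. (g x)\<^sup>2)"
proof -
  let ?I = "\<lambda>m. {l m<..<u m}"
  have I: "?I m \<subseteq> {0..<1}" if "m \<in> M" for m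
    using sub[OF that] by auto
  have meas: "measure circle (?I m) = u m - l m" "?I m \<in> sets circle" if "m \<in> M" for m
    using I[OF that] sub[OF that]
    by (auto simp: circle_def measure_restrict_space sets_restrict_space_iff)
  have "(\<Sum>m\<in>M. (C m)\<^sup>2 * (u m - l m)) = (LINT x|circle. (\<Sum>m\<in>M. (C m)\<^sup>2 * indicator (?I m) x))"
    using meas by (subst Bochner_Integration.integral_sum)
      (auto simp: Int_absorb2 circle.emeasure_eq_measure dest!: sets.sets_into_space)
  also have "\<dots> \<le> (LINT x|circle. (g x)\<^sup>2)"
  proof (rule integral_mono)
    show "integrable circle (\<lambda>x. \<Sum>m\<in>M. (C m)\<^sup>2 * indicator (?I m) x)"
      using meas by (intro Bochner_Integration.integrable_sum integrable_mult_right)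
        (auto simp: circle.emeasure_eq_measure)
    show "integrable circle (\<lambda>x. (g x)\<^sup>2)"
      using g by (simp add: L2_def)
    show "(\<Sum>m\<in>M. (C m)\<^sup>2 * indicator (?I m) x) \<le> (g x)\<^sup>2" for x
    proof (cases "\<exists>m\<in>M. x \<in> ?I m")
      case True
      then obtain m where m: "m \<in> M" "x \<in> ?I m" by blast
      have "x \<notin> ?I i" if "i \<in> M" "i \<noteq> m" for i
        using m M(2) that unfolding disjoint_family_on_def by blast
      then have "(\<Sum>i\<in>M. (C i)\<^sup>2 * indicator (?I i) x) = (\<Sum>i\<in>M. if i = m then (C i)\<^sup>2 else 0)"
        using m by (intro sum.cong) (auto simp del: greaterThanLessThan_iff)
      also have "\<dots> = (C m)\<^sup>2"
        using m M(1) by simp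
      also have "\<dots> \<le> (g x)\<^sup>2"
        using C[OF m] by (intro power_mono) auto
      finally show ?thesis .
    next
      case False
      then have "(\<Sum>m\<in>M. (C m)\<^sup>2 * indicator (?I m) x) = 0"
        by (intro sum.neutral) (auto simp: indicator_def)
      then show ?thesis by simp
    qed
  qed
  finally show ?thesis .
qed

section \<open>Sums over a sector\<close>

lemma sin_ge_half:
  fixes x :: real
  assumes "0 \<le> x" "x \<le> pi / 3"
  shows "x / 2 \<le> sin x"
proof -
  have "(\<lambda>x. sin x - x / 2) 0 \<le> (\<lambda>x. sin x - x / 2) x"
  proof (rule DERIV_nonneg_imp_nondecreasing[OF assms(1)])
    fix y :: real assume y: "0 \<le> y" "y \<le> x"
    have "cos (pi / 3) \<le> cos y"
      using y assms by (intro cos_monotone_0_pi_le) auto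
    then show "\<exists>d. ((\<lambda>x. sin x - x / 2) has_real_derivative d) (at y) \<and> 0 \<le> d"
      by (intro exI[of _ "cos y - 1 / 2"]) (auto intro!: derivative_eq_intros simp: cos_60)
  qed
  then show ?thesis by simp
qed

lemma norm_wave_minus_1: "cmod (wave 1 x - 1) = 2 * \<bar>sin (pi * x)\<bar>"
  using dist_exp_i_1[of "2 * pi * x"] by (simp add: wave_def cis_conv_exp mult_ac)

lemma norm_wave_minus_1_le:
  assumes "0 \<le> x"
  shows "cmod (wave 1 x - 1) \<le> 7 * x"
proof -
  have "cmod (wave 1 x - 1) \<le> 2 * (pi * x)"
    unfolding norm_wave_minus_1 using abs_sin_le_one abs_sin_x_le_abs_x[of "pi * x"] assms by simp
  also have "\<dots> \<le> 7 * x"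
    using mult_right_mono[of "2 * pi" 7 x] pi_approx assms by simp
  finally show ?thesis .
qed

lemma norm_wave_minus_1_ge:
  assumes "0 \<le> x" "x \<le> 1 / 3"
  shows "2 * x \<le> cmod (wave 1 x - 1)"
proof -
  have "2 * x \<le> pi * x"
    using assms pi_gt3 by (intro mult_right_mono) auto
  also have "\<dots> \<le> 2 * sin (pi * x)"
    using sin_ge_half[of "pi * x"] assms by (simp add: field_simps)
  also have "\<dots> \<le> cmod (wave 1 x - 1)"
    unfolding norm_wave_minus_1 by simp
  finally show ?thesis .
qed

text \<open>The form without division avoids a case distinction at integers x, where
  \<open>wave 1 x - 1\<close> vanishes.\<close>

lemma geometric_wave:
  assumes "m \<le> n"
  shows "(\<Sum>b=m..<n. wave (int b) x) * (wave 1 x - 1) = wave (int n) x - wave (int m) x"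
proof -
  have "(\<Sum>b=m..<n. wave (int b) x) * (wave 1 x - 1) = (\<Sum>b=m..<n. wave (int (Suc b)) x - wave (int b) x)"
    by (simp add: sum_distrib_right right_diff_distrib wave_mult add.commute sum_subtractf)
  also have "\<dots> = wave (int n) x - wave (int m) x"
    using sum_Suc_diff'[OF assms, of "\<lambda>b. wave (int b) x"] .
  finally show ?thesis .
qed

lemma Re_wave: "Re (wave k x) = cos (2 * pi * of_int k * x)"
  by (simp add: wave_def)

text \<open>The geometric sum has a numerator of modulus at most 2 and a denominator of modulus at
  least 2s, whatever its length.\<close>

lemma abs_cos_sum_le:
  assumes s: "0 < s" "s \<le> 1 / 3"
  shows "\<bar>\<Sum>a=m..<n. cos (2 * pi * real a * s)\<bar> \<le> 1 / s"
proof (cases "m \<le> n")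
  case True
  have "(\<Sum>a=m..<n. cos (2 * pi * real a * s)) = Re (\<Sum>a=m..<n. wave (int a) s)"
    by (simp add: Re_wave)
  then have "\<bar>\<Sum>a=m..<n. cos (2 * pi * real a * s)\<bar> \<le> cmod (\<Sum>a=m..<n. wave (int a) s)"
    using abs_Re_le_cmod by metis
  also have "cmod (\<Sum>a=m..<n. wave (int a) s) * (2 * s)
      \<le> cmod (\<Sum>a=m..<n. wave (int a) s) * cmod (wave 1 s - 1)"
    using s by (intro mult_left_mono norm_wave_minus_1_ge) auto
  also have "\<dots> \<le> 2"
    unfolding norm_mult[symmetric] geometric_wave[OF True]
    using norm_triangle_ineq4[of "wave (int n) s" "wave (int m) s"] by simp
  finally show ?thesis using s by (simp add: field_simps)
qed (use s in auto)

section \<open>Dyadic weights\<close>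

lemma sum_dyadic:
  fixes g :: "nat \<Rightarrow> 'a :: comm_monoid_add"
  shows "(\<Sum>a\<in>{1..<2 ^ K}. g a) = (\<Sum>k<K. \<Sum>a\<in>{2 ^ k..<2 ^ Suc k}. g a)"
proof (induction K)
  case (Suc K)
  then show ?case
    using sum.atLeastLessThan_concat[of 1 "2 ^ K" "2 ^ Suc K" g] by simp
qed simp

text \<open>A substitute for \<open>1/a\<close> that is constant on dyadic blocks, which avoids summation by parts.\<close>

definition wt :: "nat \<Rightarrow> real" where
  "wt a = 1 / 2 ^ nat \<lfloor>log 2 (real a)\<rfloor>"

lemma wt_dyadic:
  assumes "a \<in> {2 ^ k..<2 ^ Suc k}"
  shows "wt a = 1 / 2 ^ k"
proof -
  have "\<lfloor>log (real 2) (real a)\<rfloor> = int k"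
    using assms by (intro floor_log_nat_eq_if) auto
  then show ?thesis by (simp add: wt_def)
qed

lemma wt_nonneg: "0 \<le> wt a"
  by (simp add: wt_def)

lemma sum_wt: "(\<Sum>a\<in>{1..<2 ^ K}. wt a * g a) = (\<Sum>k<K. (\<Sum>a\<in>{2 ^ k..<2 ^ Suc k}. g a) / 2 ^ k)"
  unfolding sum_dyadic sum_divide_distrib by (intro sum.cong) (simp_all add: wt_dyadic)

lemma sum_wt_1: "(\<Sum>a\<in>{1..<2 ^ K}. wt a) = real K"
  using sum_wt[of "\<lambda>_. 1" K] by simp

text \<open>This will bound the squared norm of the test function, in which each a carries a
  frequencies with coefficient \<open>wt a\<close>. As a times \<open>wt a\<close> is at most 2, the
  sum is at most twice that of the weights.\<close>

lemma sum_wt_square_le: "(\<Sum>a\<in>{1..<2 ^ K}. real a * (wt a)\<^sup>2) \<le> 2 * real K"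
proof -
  have "(\<Sum>a\<in>{1..<2 ^ K}. real a * (wt a)\<^sup>2) \<le> (\<Sum>a\<in>{1..<2 ^ K}. wt a * 2)"
  proof (rule sum_mono)
    fix a :: nat assume a: "a \<in> {1..<2 ^ K}"
    have "real a * wt a \<le> 2"
    proof -
      let ?k = "nat \<lfloor>log 2 (real a)\<rfloor>"
      have "log 2 (real a) \<le> real (Suc ?k)" by linarith
      then have "real a \<le> 2 ^ Suc ?k"
        using a by (simp add: log_le_iff powr_add flip: powr_realpow)
      then show ?thesis by (simp add: wt_def field_simps)
    qed
    then have "(real a * wt a) * wt a \<le> 2 * wt a"
      using wt_nonneg by (rule mult_right_mono)
    then show "real a * (wt a)\<^sup>2 \<le> wt a * 2"
      by (simp only: power2_eq_square mult_ac)
  qed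
  also have "\<dots> = 2 * real K"
    using sum_wt_1[of K] by (simp flip: sum_distrib_right)
  finally show ?thesis .
qed

text \<open>Each block k < j contributes at most 1. From k = j on, oscillation bounds the block sum
  by 1/s, hence by 2 * 2^j, and division by 2^k leaves a geometric tail of total at most 4. The
  bound is therefore independent of \<open>K\<close>.\<close>

lemma sum_wt_cos_le:
  assumes s: "0 < s" "s \<le> 1 / 3" and j: "1 / 2 ^ j \<le> 2 * s"
  shows "(\<Sum>a\<in>{1..<2 ^ K}. wt a * cos (2 * pi * real a * s)) \<le> real j + 4"
proof -
  have "(\<Sum>a\<in>{1..<2 ^ K}. wt a * cos (2 * pi * real a * s))
      \<le> (\<Sum>k<K. (if k < j then 1 else 0) + 2 * 2 ^ j * (if j \<le> k then (1 / 2) ^ k else 0))"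
    unfolding sum_wt
  proof (rule sum_mono)
    fix k
    let ?B = "\<Sum>a\<in>{2 ^ k..<2 ^ Suc k}. cos (2 * pi * real a * s)"
    show "?B / 2 ^ k \<le> (if k < j then 1 else 0) + 2 * 2 ^ j * (if j \<le> k then (1 / 2) ^ k else 0)"
    proof (cases "k < j")
      case True
      have "?B \<le> (\<Sum>a\<in>{2 ^ k..<2 ^ Suc k::nat}. 1)"
        by (intro sum_mono) simp
      then show ?thesis using True by (simp add: field_simps)
    next
      case False
      have "?B \<le> 1 / s"
        using abs_cos_sum_le[OF s, of "2 ^ k" "2 ^ Suc k"] by linarith
      also have "\<dots> \<le> 2 * 2 ^ j"
        using j s by (simp add: field_simps)
      finally show ?thesis using False by (simp add: field_simps power_one_over)
    qed
  qed
  also have "\<dots> = (\<Sum>k<K. if k < j then 1 else 0) + 2 * 2 ^ j * (\<Sum>k<K. if j \<le> k then (1 / 2) ^ k else 0)"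
    by (simp only: sum.distrib sum_distrib_left)
  also have "\<dots> \<le> real j + 2 * 2 ^ j * (2 * (1 / 2) ^ j)"
  proof (intro add_mono mult_left_mono)
    have "(\<Sum>k<K. if k < j then 1 else 0) = (\<Sum>k\<in>{..<K} \<inter> {..<j}. 1::real)"
      by (subst sum.inter_restrict) auto
    also have "\<dots> \<le> real j"
      using card_mono[of "{..<j}" "{..<K} \<inter> {..<j}"] by simp
    finally show "(\<Sum>k<K. if k < j then 1 else 0) \<le> real j" .
    have "(\<Sum>k<K. if j \<le> k then (1 / 2) ^ k else 0) = (\<Sum>k=j..<K. (1 / 2::real) ^ k)"
      by (subst sum.inter_filter[symmetric]) (auto intro!: sum.cong)
    also have "\<dots> \<le> 2 * (1 / 2) ^ j"
      by (cases "j \<le> K") (simp_all add: sum_gp_strict sum_gp0 geometric_sum power_diff atLeast0LessThan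
          sum_diff_nat_ivl[of 0 j K "\<lambda>k. (1/2::real)^k", unfolded atLeast0LessThan, symmetric])
    finally show "(\<Sum>k<K. if j \<le> k then (1 / 2) ^ k else 0) \<le> 2 * (1 / 2::real) ^ j" .
  qed auto
  also have "\<dots> = real j + 4"
    by (simp add: power_one_over)
  finally show ?thesis .
qed

text \<open>By \<open>Px\<close> the frequency aP + b has phase bx - at modulo 1, which vanishes on
  the line of slope \<open>\<theta>\<close>. Summation over b leaves two end-point waves divided by
  \<open>wave 1 x - 1\<close>. Those at b = a rotate with a, and the real part of their weighted sum
  is at most j + 4; those at the cut-off stay near phase 0, and the real part of theirs is at least
  2j.\<close>

lemma fan_sum_ge:
  fixes j m :: nat and t x :: real
  defines "P \<equiv> 2 ^ (4 * j)" and "\<theta> \<equiv> t / x"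
  defines "S \<equiv> (\<Sum>a\<in>{1..<P}. \<Sum>b\<in>{nat \<lceil>\<theta> * real a\<rceil>..<a}. of_real (wt a) * wave (int (a * P + b)) x)"
  assumes Px: "real P * x = real m - t" and t: "0 \<le> t" "t \<le> x / 2" and j: "8 \<le> j"
    and x: "1 / 2 ^ j \<le> x" "x \<le> 1 / 8"
  shows "real j / (14 * x) \<le> cmod S"
proof -
  have x0: "0 < x" using x(1) by (rule less_le_trans[rotated]) simp
  have \<theta>: "0 \<le> \<theta>" "\<theta> \<le> 1" using t x0 by (auto simp: \<theta>_def field_simps)
  \<comment> \<open>The end point b = a has phase as, and the end point b = \<open>n a\<close> has
    phase \<open>\<delta> a\<close>, which is nonzero only through the rounding of
    \<open>\<theta> * real a\<close>.\<close>
  define s where "s = x - t"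
  define n where "n a = nat \<lceil>\<theta> * real a\<rceil>" for a
  define \<delta> where "\<delta> a = x * (real (n a) - \<theta> * real a)" for a
  have n: "real (n a) - \<theta> * real a \<in> {0..1}" "n a \<le> a" for a
  proof -
    have "real (n a) = of_int \<lceil>\<theta> * real a\<rceil>"
      using \<theta> by (simp add: n_def)
    then show "real (n a) - \<theta> * real a \<in> {0..1}"
      using ceiling_correct[of "\<theta> * real a"] by auto
    have "\<theta> * real a \<le> real a" using \<theta> by (simp add: mult_left_le_one_le)
    then show "n a \<le> a" by (simp add: n_def nat_le_iff ceiling_le_iff)
  qed
  have inner: "(\<Sum>b\<in>{n a..<a}. of_real (wt a) * wave (int (a * P + b)) x) * (wave 1 x - 1)
      = of_real (wt a) * (wave (int a) s - wave 1 (\<delta> a))" for a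
  proof -
    have aP: "wave (int (a * P + b)) x = cis (- (2 * pi * real a * t)) * wave (int b) x" for b
    proof -
      have "wave (int (a * P + b)) x = cis (2 * pi * real a * (real P * x)) * wave (int b) x"
        by (simp add: wave_def cis_mult algebra_simps)
      also have "cis (2 * pi * real a * (real P * x)) = cis (2 * pi * real (a * m)) * cis (- (2 * pi * real a * t))"
        unfolding Px by (simp add: cis_mult algebra_simps)
      also have "cis (2 * pi * real (a * m)) = 1"
        by (rule cis_multiple_2pi) auto
      finally show ?thesis by simp
    qed
    have "(\<Sum>b\<in>{n a..<a}. of_real (wt a) * wave (int (a * P + b)) x) * (wave 1 x - 1)
        = of_real (wt a) * cis (- (2 * pi * real a * t)) * ((\<Sum>b\<in>{n a..<a}. wave (int b) x) * (wave 1 x - 1))"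
      unfolding aP by (simp add: sum_distrib_left sum_distrib_right mult_ac)
    also have "\<dots> = of_real (wt a) * (cis (- (2 * pi * real a * t)) * wave (int a) x
        - cis (- (2 * pi * real a * t)) * wave (int (n a)) x)"
      unfolding geometric_wave[OF n(2)] by (simp add: right_diff_distrib mult.assoc)
    also have "cis (- (2 * pi * real a * t)) * wave (int a) x = wave (int a) s"
      by (simp add: wave_def cis_mult s_def algebra_simps)
    also have "cis (- (2 * pi * real a * t)) * wave (int (n a)) x = wave 1 (\<delta> a)"
      using x0 by (simp add: wave_def cis_mult \<delta>_def \<theta>_def algebra_simps)
    finally show ?thesis .
  qed
  have S: "S * (wave 1 x - 1) = (\<Sum>a\<in>{1..<P}. of_real (wt a) * (wave (int a) s - wave 1 (\<delta> a)))"
    unfolding S_def n_def[symmetric] sum_distrib_right[of _ "{1..<P}"] inner ..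
  \<comment> \<open>Rounding moves the phase by at most x, and x <= 1/8 < 1/6 keeps the angle below
    pi/3.\<close>
  have cos_\<delta>: "1 / 2 \<le> cos (2 * pi * \<delta> a)" for a
  proof -
    have "0 \<le> \<delta> a" "\<delta> a \<le> x * 1"
      unfolding \<delta>_def using n(1)[of a] x0 by (auto intro!: mult_left_mono)
    then have "cos (pi / 3) \<le> cos (2 * pi * \<delta> a)"
      using x by (intro cos_monotone_0_pi_le) (auto simp: field_simps)
    then show ?thesis by (simp add: cos_60)
  qed
  have "Re (S * (wave 1 x - 1)) = (\<Sum>a\<in>{1..<P}. wt a * (cos (2 * pi * real a * s) - cos (2 * pi * \<delta> a)))"
    unfolding S by (simp add: Re_wave)
  also have "\<dots> \<le> (\<Sum>a\<in>{1..<P}. wt a * (cos (2 * pi * real a * s) - 1 / 2))"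
    using cos_\<delta> wt_nonneg by (intro sum_mono mult_left_mono) auto
  also have "\<dots> = (\<Sum>a\<in>{1..<P}. wt a * cos (2 * pi * real a * s)) - (\<Sum>a\<in>{1..<P}. wt a) / 2"
    by (simp add: right_diff_distrib sum_subtractf sum_divide_distrib)
  \<comment> \<open>The exponent 4j in \<open>P\<close> makes the weights sum to 4j, half of which
    exceeds j + 4 by at least j/2 when j >= 8. The hypothesis t <= x/2 gives 2s >= x >=
    1/2^j.\<close>
  also have "\<dots> \<le> (real j + 4) - real (4 * j) / 2"
    unfolding P_def sum_wt_1 using x t x0
    by (intro diff_right_mono sum_wt_cos_le) (auto simp: s_def)
  also have "\<dots> \<le> - (real j / 2)"
    using j by simp
  finally have "real j / 2 \<le> \<bar>Re (S * (wave 1 x - 1))\<bar>" by linarith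
  also have "\<dots> \<le> cmod (S * (wave 1 x - 1))" by (rule abs_Re_le_cmod)
  also have "\<dots> \<le> cmod S * (7 * x)"
    unfolding norm_mult using norm_wave_minus_1_le[of x] x0 by (intro mult_left_mono) auto
  finally show ?thesis
    using x0 by (simp add: field_simps)
qed

section \<open>Frequencies ordered by slope\<close>

text \<open>Each dyadic block of the harmonic series contributes at least 1/2.\<close>

lemma sum_inverse_ge:
  assumes "p \<le> q"
  shows "real (q - p) / 2 \<le> (\<Sum>m\<in>{2 ^ p<..2 ^ q::nat}. 1 / real m)"
  using assms
proof (induction q rule: dec_induct)
  case base
  then show ?case by simp
next
  case (step q)
  have "{2 ^ p<..2 ^ Suc q} = {2 ^ p<..2 ^ q} \<union> {2 ^ q<..2 ^ Suc q::nat}"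
  proof (rule set_eqI)
    fix x :: nat
    have "2 ^ p \<le> (2::nat) ^ q" "2 ^ q \<le> (2::nat) ^ Suc q"
      using step(1) by simp_all
    then show "x \<in> {2 ^ p<..2 ^ Suc q} \<longleftrightarrow> x \<in> {2 ^ p<..2 ^ q} \<union> {2 ^ q<..2 ^ Suc q}"
      unfolding Un_iff greaterThanAtMost_iff by linarith
  qed
  then have "(\<Sum>m\<in>{2 ^ p<..2 ^ Suc q::nat}. 1 / real m)
      = (\<Sum>m\<in>{2 ^ p<..2 ^ q::nat}. 1 / real m) + (\<Sum>m\<in>{2 ^ q<..2 ^ Suc q::nat}. 1 / real m)"
    by (simp only:) (intro sum.union_disjoint, auto)
  moreover have "(\<Sum>m\<in>{2 ^ q<..2 ^ Suc q::nat}. 1 / 2 ^ Suc q) \<le> (\<Sum>m\<in>{2 ^ q<..2 ^ Suc q::nat}. 1 / real m)"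
  proof (rule sum_mono)
    fix m :: nat assume m: "m \<in> {2 ^ q<..2 ^ Suc q}"
    then have "real m \<le> real (2 ^ Suc q)" unfolding of_nat_le_iff by simp
    with m show "1 / 2 ^ Suc q \<le> 1 / real m"
      by (intro divide_left_mono) auto
  qed
  moreover have "(\<Sum>m\<in>{2 ^ q<..2 ^ Suc q::nat}. 1 / 2 ^ Suc q) = (1 / 2 :: real)"
    by simp
  ultimately show ?case
    using step by (simp add: Suc_diff_le)
qed

definition freqs :: "nat \<Rightarrow> nat set" where
  "freqs P = (\<lambda>(a, b). a * P + b) ` (SIGMA a:{1..<P}. {..<a})"

lemma freqs_subset: "freqs P \<subseteq> {1..<P * P}"
proof -
  have "1 \<le> a * P + b \<and> a * P + b < P * P" if "1 \<le> a" "a < P" "b < a" for a b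
  proof -
    have "Suc a * P \<le> P * P" using that by (intro mult_le_mono1) auto
    moreover have "0 < a * P" using that by simp
    ultimately show ?thesis using that unfolding mult_Suc by linarith
  qed
  then show ?thesis by (force simp: freqs_def)
qed

lemma finite_freqs: "finite (freqs P)"
  by (simp add: freqs_def)

lemma sum_freqs:
  "(\<Sum>k\<in>freqs P. g k) = (\<Sum>a\<in>{1..<P}. \<Sum>b<a. g (a * P + b))"
proof -
  have "inj_on (\<lambda>(a, b). a * P + b) (SIGMA a:{1..<P}. {..<a})"
  proof (rule inj_onI, clarsimp)
    fix a b a' b' :: nat
    assume "b < a" "a < P" "b' < a'" "a' < P" and eq: "a * P + b = a' * P + b'"
    have "(i * P + k) div P = i" if "k < i" "i < P" for i k
      using that by simp
    from this[OF \<open>b < a\<close> \<open>a < P\<close>] this[OF \<open>b' < a'\<close> \<open>a' < P\<close>]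
    have "a = a'" using eq by metis
    with eq show "a = a' \<and> b = b'" by simp
  qed
  then show ?thesis
    unfolding freqs_def by (simp add: sum.reindex sum.Sigma case_prod_unfold)
qed

text \<open>The base-P digits of aP + b in \<open>freqs P\<close> are a and b. Numbers outside
  \<open>freqs P\<close> only need some place in the order, as the test function has no coefficient
  there; for k < P division by zero gives the value 0.\<close>

definition slope :: "nat \<Rightarrow> nat \<Rightarrow> real" where
  "slope P k = real (k mod P) / real (k div P)"

text \<open>Rewrites an initial segment of the slope order as the double sum estimated in
  \<open>fan_sum_ge\<close>; since b is an integer, the slope condition becomes a ceiling.\<close>

lemma sum_freqs_slope:
  assumes "0 \<le> \<theta>"
  shows "(\<Sum>k\<in>{k \<in> freqs P. \<theta> \<le> slope P k}. g k)
    = (\<Sum>a\<in>{1..<P}. \<Sum>b\<in>{nat \<lceil>\<theta> * real a\<rceil>..<a}. g (a * P + b))"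
proof -
  have "(\<Sum>k\<in>{k \<in> freqs P. \<theta> \<le> slope P k}. g k)
      = (\<Sum>k\<in>freqs P. if \<theta> \<le> slope P k then g k else 0)"
    by (rule sum.inter_filter) (rule finite_freqs)
  also have "\<dots> = (\<Sum>a\<in>{1..<P}. \<Sum>b<a. if \<theta> \<le> slope P (a * P + b) then g (a * P + b) else 0)"
    by (rule sum_freqs)
  also have "\<dots> = (\<Sum>a\<in>{1..<P}. \<Sum>b\<in>{nat \<lceil>\<theta> * real a\<rceil>..<a}. g (a * P + b))"
  proof (rule sum.cong[OF refl])
    fix a assume a: "a \<in> {1..<P}"
    have "\<theta> \<le> slope P (a * P + b) \<longleftrightarrow> nat \<lceil>\<theta> * real a\<rceil> \<le> b" if "b < a" for b
      using a that by (simp add: slope_def field_simps nat_le_iff ceiling_le_iff)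
    then have "{b \<in> {..<a}. \<theta> \<le> slope P (a * P + b)} = {nat \<lceil>\<theta> * real a\<rceil>..<a}"
      by auto
    then show "(\<Sum>b<a. if \<theta> \<le> slope P (a * P + b) then g (a * P + b) else 0)
        = (\<Sum>b\<in>{nat \<lceil>\<theta> * real a\<rceil>..<a}. g (a * P + b))"
      by (subst sum.inter_filter[symmetric]) auto
  qed
  finally show ?thesis .
qed

text \<open>The test function has squared norm at most 8j. Its maximal sum is at least j/(14x) on a
  set that fills a fraction of about x/2 of each cell of length 1/P, and the square of j/x
  integrated against this density is of order j^3.\<close>

lemma opnorm_slope_order_ge:
  fixes j N :: nat
  defines "P \<equiv> 2 ^ (4 * j)"
  assumes j: "8 \<le> j" and N: "P * P \<le> N" and \<sigma>: "\<sigma> permutes {1..N}"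
    and sorted: "\<And>\<theta>. \<exists>m\<le>N. \<sigma> ` {1..m} = {k \<in> {1..N}. \<theta> \<le> slope P k}"
  shows "ereal (real j / 160) \<le> L2_opnorm (max_partial_sum \<sigma> N)"
proof -
  define c :: "nat \<Rightarrow> complex" where "c k = of_real (wt (k div P))" for k
  define f where "f x = (\<Sum>k\<in>freqs P. c k * wave (int k) x)" for x
  note f = trig_poly_L2[OF finite_freqs, of c P, folded f_def]
  have P: "P \<ge> 1" "real P > 0" by (simp_all add: P_def)
  have N1: "1 \<le> N" using N P(1) by (metis le_trans mult_le_mono nat_mult_1)
  have coeff: "fourier_coeff f (int k) = (if k \<in> freqs P then c k else 0)" for k
    unfolding f_def using fourier_coeff_trig_poly[OF finite_freqs] .
  have c: "c (a * P + b) = of_real (wt a)" if "a \<in> {1..<P}" "b < a" for a b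
    using that by (simp add: c_def)
  have "(\<Sum>k\<in>freqs P. (cmod (c k))\<^sup>2) = (\<Sum>a\<in>{1..<P}. real a * (wt a)\<^sup>2)"
    unfolding sum_freqs by (intro sum.cong) (auto simp: c)
  also have "\<dots> \<le> 2 * real (4 * j)"
    unfolding P_def by (rule sum_wt_square_le)
  finally have D: "(LINT x|circle. (cmod (f x))\<^sup>2) \<le> 8 * real j"
    unfolding f(2) by simp
  have pointwise: "real j / (14 * x) \<le> max_partial_sum \<sigma> N f x"
    if Px: "real P * x = real m - t" and t: "0 \<le> t" "t \<le> x / 2" and x: "1 / 2 ^ j \<le> x" "x \<le> 1 / 8"
    for m :: nat and t x :: real
  proof -
    have x0: "0 < x" using x(1) by (rule less_le_trans[rotated]) simp
    then have \<theta>: "0 \<le> t / x" using t by simp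
    \<comment> \<open>The stopping index depends on x through the slope t/x; this is where the
      maximum is exploited.\<close>
    obtain i where i: "i \<le> N" "\<sigma> ` {1..i} = {k \<in> {1..N}. t / x \<le> slope P k}"
      using sorted by blast
    have "(\<Sum>k=1..i. fourier_coeff f (int (\<sigma> k)) * wave (int (\<sigma> k)) x)
        = (\<Sum>k\<in>\<sigma> ` {1..i}. fourier_coeff f (int k) * wave (int k) x)"
      by (subst sum.reindex) (auto intro: inj_on_subset[OF permutes_inj[OF \<sigma>]])
    also have "\<dots> = (\<Sum>k\<in>{k \<in> freqs P. t / x \<le> slope P k}. c k * wave (int k) x)"
      unfolding i(2) coeff using freqs_subset[of P] N
      by (intro sum.mono_neutral_cong_right) (auto simp: coeff)
    also have "\<dots> = (\<Sum>a\<in>{1..<P}. \<Sum>b\<in>{nat \<lceil>t / x * real a\<rceil>..<a}. of_real (wt a) * wave (int (a * P + b)) x)"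
      unfolding sum_freqs_slope[OF \<theta>] by (intro sum.cong) (auto simp: c)
    finally have "cmod \<dots> \<le> max_partial_sum \<sigma> N f x"
      using max_partial_sum_ge[OF i(1) N1, of f \<sigma> x] by simp
    then show ?thesis
      using fan_sum_ge[OF Px[unfolded P_def] t j x] unfolding P_def by linarith
  qed
  \<comment> \<open>For these m, the points x used near m/P lie between 1/2^j and 1/8.\<close>
  define M where "M = {2 ^ (3 * j)<..2 ^ (4 * j - 3) :: nat}"
  \<comment> \<open>On the interval from \<open>l m\<close> to \<open>u m\<close>, t = m - Px is at
    most (m - 1)/(2P), hence at most x/2, because x >= (m - 1)/P.\<close>
  define l where "l m = (real m - (real m - 1) / (2 * real P)) / real P" for m
  define u where "u m = real m / real P" for m
  \<comment> \<open>The pointwise bound j/(14x) decreases in x; this is its value at the right end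
    point m/P.\<close>
  define C where "C m = real j * real P / (14 * real m)" for m
  have M: "1 / 2 ^ j * real P \<le> real m - 1" "real m \<le> real P / 8" "1 < m" "real m \<le> real P" if "m \<in> M" for m
  proof -
    have "2 ^ (3 * j) + 1 \<le> m" using that by (simp add: M_def)
    then have "real (2 ^ (3 * j) + 1) \<le> real m" unfolding of_nat_le_iff .
    moreover have "real P = 2 ^ (3 * j) * 2 ^ j" by (simp add: P_def flip: power_add)
    ultimately show "1 / 2 ^ j * real P \<le> real m - 1" by simp
    have "m \<le> 2 ^ (4 * j - 3)" using that by (simp add: M_def)
    then have "real m \<le> real (2 ^ (4 * j - 3))" unfolding of_nat_le_iff .
    also have "\<dots> = real P / 8"
    proof -
      have "4 * j = (4 * j - 3) + 3" using j by simp
      then have "P = 2 ^ (4 * j - 3) * 2 ^ 3" unfolding P_def by (metis power_add)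
      then show ?thesis by simp
    qed
    finally show "real m \<le> real P / 8" .
    then show "real m \<le> real P" using P by simp
    have "(1::nat) \<le> 2 ^ (3 * j)" by simp
    then show "1 < m" using \<open>2 ^ (3 * j) + 1 \<le> m\<close> by linarith
  qed
  have l: "(real m - 1) / real P \<le> l m" "l m \<le> u m" if "m \<in> M" for m
  proof -
    have "(real m - 1) / (2 * real P) \<le> 1"
      using M(3,4)[OF that] P by (simp add: field_simps)
    then show "(real m - 1) / real P \<le> l m"
      unfolding l_def using P by (intro divide_right_mono) auto
    show "l m \<le> u m"
      unfolding l_def u_def using P M(3)[OF that] by (intro divide_right_mono) auto
  qed
  have lower: "0 \<le> C m \<and> C m \<le> max_partial_sum \<sigma> N f x" if m: "m \<in> M" and x: "x \<in> {l m<..<u m}" for m x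
  proof
    define t where "t = real m - real P * x"
    have x1: "(real m - 1) / real P \<le> x" using l(1)[OF m] x by simp
    have "1 / 2 ^ j \<le> (real m - 1) / real P"
      using M(1)[OF m] P by (simp add: field_simps)
    with x1 have xj: "1 / 2 ^ j \<le> x" by linarith
    have x0: "0 < x" using xj by (rule less_le_trans[rotated]) simp
    have xm: "real P * x < real m" using x P by (simp add: u_def field_simps)
    then have "real P * x \<le> real P * (1 / 8)" using M(2)[OF m] by linarith
    then have x8: "x \<le> 1 / 8" using P by (simp only: mult_le_cancel_left_pos)
    have t0: "0 \<le> t" using xm by (simp add: t_def)
    have "real m - (real m - 1) / (2 * real P) < x * real P"
      using x P(2) unfolding l_def by (simp add: pos_divide_less_eq)
    then have "t \<le> (real m - 1) / (2 * real P)"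
      by (simp add: t_def mult.commute)
    also have "\<dots> \<le> x / 2" using x1 P by (simp add: field_simps)
    finally have t2: "t \<le> x / 2" .
    have "C m \<le> real j / (14 * x)"
    proof -
      have "C m = real j / (14 * (real m / real P))" using P by (simp add: C_def)
      also have "\<dots> \<le> real j / (14 * x)"
        using x x0 P M(3)[OF m] by (intro divide_left_mono mult_pos_pos divide_pos_pos) (auto simp: u_def)
      finally show ?thesis .
    qed
    also have "\<dots> \<le> max_partial_sum \<sigma> N f x"
      using t0 t2 xj x8 by (intro pointwise[of x m t]) (auto simp: t_def)
    finally show "C m \<le> max_partial_sum \<sigma> N f x" .
    show "0 \<le> C m" by (simp add: C_def)
  qed
  have disj: "disjoint_family_on (\<lambda>m. {l m<..<u m}) M"
  proof -
    have "{l m<..<u m} \<inter> {l n<..<u n} = {}" if "m \<in> M" "n \<in> M" "m < n" for m n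
    proof -
      have "u m \<le> (real n - 1) / real P"
        unfolding u_def using that P by (intro divide_right_mono) auto
      also have "\<dots> \<le> l n" using l(1) that by blast
      finally show ?thesis by auto
    qed
    then show ?thesis
      unfolding disjoint_family_on_def by (metis Int_commute linorder_neqE_nat)
  qed
  have summand: "(real j)\<^sup>2 / 784 * (1 / real m) \<le> (C m)\<^sup>2 * (u m - l m)" if m: "m \<in> M" for m
  proof -
    \<comment> \<open>As m >= 2, m - 1 is at least m/2; the constant below is 784 = 14^2 *
      4.\<close>
    have "(real m / 2) / (2 * (real P)\<^sup>2) \<le> (real m - 1) / (2 * (real P)\<^sup>2)"
      using M(3)[OF m] by (intro divide_right_mono) auto
    also have "\<dots> = u m - l m"
      using P by (simp add: u_def l_def field_simps power2_eq_square)
    finally have "(C m)\<^sup>2 * ((real m / 2) / (2 * (real P)\<^sup>2)) \<le> (C m)\<^sup>2 * (u m - l m)"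
      by (intro mult_left_mono) auto
    moreover have "(C m)\<^sup>2 * ((real m / 2) / (2 * (real P)\<^sup>2)) = (real j)\<^sup>2 / 784 * (1 / real m)"
      using P M(3)[OF m] by (simp add: C_def power2_eq_square field_simps)
    ultimately show ?thesis by simp
  qed
  \<comment> \<open>The constant 160 satisfies 160^2 / 8 = 3200 >= 784 * 4.\<close>
  have "(real j / 160)\<^sup>2 * (8 * real j) \<le> (real j)\<^sup>2 / 784 * (real j / 4)"
    by (simp add: power2_eq_square field_simps)
  also have "\<dots> \<le> (real j)\<^sup>2 / 784 * (\<Sum>m\<in>M. 1 / real m)"
  proof (intro mult_left_mono)
    have "real j / 4 \<le> real (4 * j - 3 - 3 * j) / 2"
      using j by (simp add: of_nat_diff)
    also have "\<dots> \<le> (\<Sum>m\<in>M. 1 / real m)"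
      unfolding M_def using j by (intro sum_inverse_ge) simp
    finally show "real j / 4 \<le> (\<Sum>m\<in>M. 1 / real m)" .
  qed simp
  also have "\<dots> \<le> (\<Sum>m\<in>M. (C m)\<^sup>2 * (u m - l m))"
    unfolding sum_distrib_left by (intro sum_mono summand)
  also have "\<dots> \<le> (LINT x|circle. (max_partial_sum \<sigma> N f x)\<^sup>2)"
  proof (rule integral_square_ge_disjoint[OF _ disj])
    show "finite M" by (simp add: M_def)
    show "0 \<le> l m \<and> l m \<le> u m \<and> u m \<le> 1" if "m \<in> M" for m
    proof -
      have "0 \<le> (real m - 1) / real P" using M(3)[OF that] by simp
      then show ?thesis
        using l[OF that] M(4)[OF that] P unfolding u_def by auto
    qed
    have "N \<le> 2 ^ N" by (simp add: less_imp_le)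
    then show "max_partial_sum \<sigma> N f \<in> L2"
      using max_partial_sum_L2(1)[OF \<sigma> N1 _ f(1)] by blast
  qed (rule lower)
  finally have "(real j / 160)\<^sup>2 * (8 * real j) \<le> (LINT x|circle. (max_partial_sum \<sigma> N f x)\<^sup>2)" .
  moreover have "0 < 8 * real j" "0 \<le> real j / 160" using j by simp_all
  ultimately show ?thesis
    using opnorm_max_partial_sum_ge[OF \<sigma> N1 f(1) D] by blast
qed

lemma slope_order_opnorm_bounds:
  fixes N :: nat
  assumes N: "N > 1"
  shows "\<exists>\<sigma>. \<sigma> permutes {1..N} \<and>
    ereal (1 / 1920 * ln (real N)) \<le> L2_opnorm (max_partial_sum \<sigma> N) \<and>
    L2_opnorm (max_partial_sum \<sigma> N) \<le> ereal (6 * ln (real N))"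
proof -
  \<comment> \<open>The largest j with 256^j <= N, where 256^j = P^2 is the room that
    \<open>freqs P\<close> needs.\<close>
  define j where "j = nat \<lfloor>log 256 (real N)\<rfloor>"
  define P :: nat where "P = 2 ^ (4 * j)"
  obtain \<sigma> where \<sigma>: "\<sigma> permutes {1..N}"
    "\<And>\<theta>. \<exists>m\<le>N. \<sigma> ` {1..m} = {k \<in> {1..N}. \<theta> \<le> slope P k}"
    using ex_sorting_permutation[of N "slope P"] by blast
  have log0: "0 \<le> log 256 (real N)" using N by simp
  have ln256: "ln 256 \<le> (6 :: real)"
  proof -
    have "ln 256 = 8 * ln (2 :: real)"
      using ln_realpow[of 2 8] by simp
    then show ?thesis using ln2_le_25_over_36 by simp
  qed
  have "log 256 (real N) \<le> real j + 1"
    unfolding j_def by linarith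
  then have "ln (real N) \<le> (real j + 1) * ln 256"
    by (simp add: log_def pos_divide_le_eq)
  also have "\<dots> \<le> (real j + 1) * 6"
    using ln256 by (intro mult_left_mono) auto
  finally have lnN: "ln (real N) \<le> 6 * real j + 6" by simp
  \<comment> \<open>Here 1920 = 160 * 12, and 6j + 6 <= 12j in the first case; in the second, ln N
    is at most 48.\<close>
  have lower: "ereal (1 / 1920 * ln (real N)) \<le> L2_opnorm (max_partial_sum \<sigma> N)"
  proof (cases "8 \<le> j")
    case True
    have "real j \<le> log 256 (real N)"
      using log0 by (simp add: j_def)
    then have "256 powr real j \<le> real N"
      using N by (simp add: le_log_iff)
    then have "real (256 ^ j) \<le> real N"
      by (simp add: powr_realpow)
    then have "256 ^ j \<le> N" by (simp only: of_nat_le_iff)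
    moreover have "P * P = 256 ^ j"
      by (simp add: P_def power_mult flip: power_mult_distrib)
    ultimately have "ereal (real j / 160) \<le> L2_opnorm (max_partial_sum \<sigma> N)"
      using opnorm_slope_order_ge[OF True _ \<sigma>[unfolded P_def]] \<open>256 ^ j \<le> N\<close>
      by (simp only: P_def)
    moreover have "ereal (1 / 1920 * ln (real N)) \<le> ereal (real j / 160)"
      using lnN True by simp
    ultimately show ?thesis by (rule order.trans[rotated])
  next
    case False
    then have "ereal (1 / 1920 * ln (real N)) \<le> ereal 1"
      using lnN by simp
    also have "\<dots> \<le> L2_opnorm (max_partial_sum \<sigma> N)"
      using N by (intro opnorm_max_partial_sum_ge_1[OF \<sigma>(1)]) simp
    finally show ?thesis .
  qed
  define r where "r = nat \<lceil>log 2 (real N)\<rceil>"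
  have r: "log 2 (real N) \<le> real r" "real r \<le> log 2 (real N) + 1"
    using N by (auto simp: r_def)
  have "real N \<le> 2 powr real r"
    using r(1) N by (simp add: log_le_iff)
  then have "real N \<le> real (2 ^ r)"
    by (simp add: powr_realpow)
  then have "N \<le> 2 ^ r" by (simp only: of_nat_le_iff)
  then have "L2_opnorm (max_partial_sum \<sigma> N) \<le> ereal (real r + 1)"
    using N by (intro opnorm_max_partial_sum_le[OF \<sigma>(1)]) simp_all
  moreover have "real r + 1 \<le> 6 * ln (real N)"
  proof -
    have "log 2 2 \<le> log 2 (real N)" using N by (subst log_le_cancel_iff) auto
    \<comment> \<open>Since N >= 2, the logarithm to base 2 is at least 1 and absorbs the additive
      constant 2.\<close>
    then have "real r + 1 \<le> 3 * log 2 (real N)" using r by simp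
    also have "\<dots> = 3 * ln (real N) / ln 2" by (simp add: log_def)
    also have "\<dots> \<le> 3 * ln (real N) / (1 / 2)"
      using N ln2_ge_two_thirds by (intro divide_left_mono) auto
    finally show ?thesis by simp
  qed
  ultimately have "L2_opnorm (max_partial_sum \<sigma> N) \<le> ereal (6 * ln (real N))"
    by (metis order.trans ereal_less_eq(3))
  with lower \<sigma>(1) show ?thesis by blast
qed

theorem theorem1p1:
  "\<exists>c1 c2 :: real. 0 < c1 \<and> c1 \<le> c2 \<and>
     (\<forall>N :: nat. N > 1 \<longrightarrow>
       (\<exists>\<sigma>. \<sigma> permutes {1..N} \<and>
          ereal (c1 * ln (real N)) \<le> L2_opnorm (max_partial_sum \<sigma> N) \<and>
          L2_opnorm (max_partial_sum \<sigma> N) \<le> ereal (c2 * ln (real N))))"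
proof (intro exI conjI)
  show "0 < (1 / 1920 :: real)" "1 / 1920 \<le> (6 :: real)" by simp_all
qed (use slope_order_opnorm_bounds in blast)

end
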